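(* Let $X$ be a nonzero real Banach lattice. For each $\varepsilon\in[0,1]$ we have $$\lambda^+(X)\le \sigma_X(\varepsilon)+2-\varepsilon.$$ Consequently, $\tilde\varepsilon_{0,m}(X)\le 2-\lambda^+(X)$.
   Context: For a Banach lattice $X$, $S_X^+$ denotes the set of elements $x\in X$ with $x\ge 0$ and $\|x\|=1$. The lattice Schäffer constant is $\lambda^+(X)=\inf\{\max\{\|x-y\|,\|x+y\|\} : x,y\in S_X^+\}$. The upper modulus of monotonicity of $X$ is $\sigma_X(\varepsilon)=\inf\{\|x+\varepsilon y\|-1 : x,y\in S_X^+\}$ for $\varepsilon\in[0,1]$, and $\tilde\varepsilon_{0,m}(X)=\sup\{\varepsilon\in[0,1) : \sigma_X(\varepsilon)=0\}$. *)

theory Defs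
  imports "HOL-Analysis.Analysis" "HOL-Library.Lattice_Algebras"
begin

text \<open>
  The modulus is fixed by the axiom \<open>\<bar>x\<bar> = sup x (- x)\<close> of \<^class>\<open>lattice_ab_group_add_abs\<close>.
\<close>

class banach_lattice = banach + ordered_real_vector + lattice_ab_group_add_abs +
  assumes norm_mono_abs: "\<bar>x\<bar> \<le> \<bar>y\<bar> \<Longrightarrow> norm x \<le> norm y"

instance real :: banach_lattice
  by standard (auto simp: sup_real_def)

definition pos_sphere :: "'a::banach_lattice set"
  where "pos_sphere = {x. 0 \<le> x \<and> norm x = 1}"

text \<open>
  The constants below depend only on the space, which is passed as a type argument.
  In a nonzero space all infima and suprema are over nonempty sets bounded on the relevant side.
\<close>

definition lattice_schaeffer_const :: "'a::banach_lattice itself \<Rightarrow> real"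
  where "lattice_schaeffer_const _ =
    Inf {max (norm (x - y)) (norm (x + y)) | x y :: 'a. x \<in> pos_sphere \<and> y \<in> pos_sphere}"

definition upper_monotonicity_modulus :: "'a::banach_lattice itself \<Rightarrow> real \<Rightarrow> real"
  where "upper_monotonicity_modulus _ \<epsilon> =
    Inf {norm (x + \<epsilon> *\<^sub>R y) - 1 | x y :: 'a. x \<in> pos_sphere \<and> y \<in> pos_sphere}"

definition upper_monotonicity_char :: "'a::banach_lattice itself \<Rightarrow> real"
  where "upper_monotonicity_char X =
    Sup {\<epsilon>. 0 \<le> \<epsilon> \<and> \<epsilon> < 1 \<and> upper_monotonicity_modulus X \<epsilon> = 0}"

end

theory Submission
  imports Defs
begin

text \<open>
  Both constants are infima over the same pairs \<open>x, y\<close> of positive unit vectors, so they can be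
  compared pair by pair. For positive vectors \<open>\<bar>x - y\<bar> \<le> x + y\<close>, hence monotonicity of the norm
  gives \<open>\<parallel>x - y\<parallel> \<le> \<parallel>x + y\<parallel>\<close>, and the maximum in the lattice Schaeffer constant is always
  \<open>\<parallel>x + y\<parallel>\<close>. Writing \<open>x + y = (x + \<epsilon>y) + (1 - \<epsilon>)y\<close>, the triangle inequality bounds it by
  \<open>\<parallel>x + \<epsilon>y\<parallel> + (1 - \<epsilon>) = (\<parallel>x + \<epsilon>y\<parallel> - 1) + 2 - \<epsilon>\<close>. Passing to the infimum over \<open>x, y\<close> gives the
  inequality. At an \<open>\<epsilon>\<close> where the modulus vanishes it says that \<open>\<epsilon>\<close> is at most 2 minus the
  Schaeffer constant, and the supremum over such \<open>\<epsilon>\<close> is the second claim.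
\<close>

lemma norm_abs_lattice [simp]: "norm \<bar>x\<bar> = norm x" for x :: "'a::banach_lattice"
  by (intro order.antisym norm_mono_abs) simp_all

lemma pos_sphere_nonempty:
  fixes x :: "'a::banach_lattice"
  assumes "x \<noteq> 0"
  obtains u :: 'a where "u \<in> pos_sphere"
proof
  show "(1 / norm x) *\<^sub>R \<bar>x\<bar> \<in> pos_sphere"
    using assms by (auto simp: pos_sphere_def intro!: scaleR_nonneg_nonneg)
qed

lemma norm_diff_le_norm_add:
  fixes x y :: "'a::banach_lattice"
  assumes "0 \<le> x" "0 \<le> y"
  shows "norm (x - y) \<le> norm (x + y)"
proof (rule norm_mono_abs)
  have "- y \<le> y" "- x \<le> x"
    using assms by (auto intro: order_trans[of _ 0])
  then have "x - y \<le> x + y" "- (x - y) \<le> x + y"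
    using add_left_mono[of "- y" y x] add_right_mono[of "- x" x y] by simp_all
  then have "\<bar>x - y\<bar> \<le> x + y"
    by (rule abs_leI)
  with assms show "\<bar>x - y\<bar> \<le> \<bar>x + y\<bar>"
    by simp
qed

lemma lattice_schaeffer_const_le:
  fixes x y :: "'a::banach_lattice"
  assumes "x \<in> pos_sphere" "y \<in> pos_sphere"
  shows "lattice_schaeffer_const TYPE('a) \<le> norm (x + y)"
proof -
  have "lattice_schaeffer_const TYPE('a) \<le> max (norm (x - y)) (norm (x + y))"
    unfolding lattice_schaeffer_const_def using assms
    by (intro cInf_lower bdd_belowI[of _ 0]) (auto simp: le_max_iff_disj)
  then show ?thesis
    using norm_diff_le_norm_add[of x y] assms by (auto simp: pos_sphere_def)
qed

lemma lattice_schaeffer_const_le_modulus: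
  fixes u :: "'a::banach_lattice"
  assumes "u \<in> pos_sphere" and "\<epsilon> \<le> 1"
  shows "lattice_schaeffer_const TYPE('a) \<le> upper_monotonicity_modulus TYPE('a) \<epsilon> + 2 - \<epsilon>"
proof -
  have "lattice_schaeffer_const TYPE('a) - 2 + \<epsilon> \<le> norm (x + \<epsilon> *\<^sub>R y) - 1"
    if "x \<in> pos_sphere" "y \<in> pos_sphere" for x y :: 'a
  proof -
    have "x + y = (x + \<epsilon> *\<^sub>R y) + (1 - \<epsilon>) *\<^sub>R y"
      by (simp add: algebra_simps)
    then have "norm (x + y) \<le> norm (x + \<epsilon> *\<^sub>R y) + norm ((1 - \<epsilon>) *\<^sub>R y)"
      by (metis norm_triangle_ineq)
    also have "norm ((1 - \<epsilon>) *\<^sub>R y) = 1 - \<epsilon>"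
      using that assms by (simp add: pos_sphere_def)
    finally show ?thesis
      using lattice_schaeffer_const_le[OF that] by simp
  qed
  then have "lattice_schaeffer_const TYPE('a) - 2 + \<epsilon> \<le> upper_monotonicity_modulus TYPE('a) \<epsilon>"
    unfolding upper_monotonicity_modulus_def using assms by (intro cInf_greatest) auto
  then show ?thesis
    by simp
qed

text \<open>
  Ensures that the supremum defining the characteristic of monotonicity runs over a nonempty set.
\<close>
lemma upper_monotonicity_modulus_0:
  fixes u :: "'a::banach_lattice"
  assumes "u \<in> pos_sphere"
  shows "upper_monotonicity_modulus TYPE('a) 0 = 0"
proof -
  have "{norm (x + 0 *\<^sub>R y) - 1 | x y :: 'a. x \<in> pos_sphere \<and> y \<in> pos_sphere} = {0}"
    using assms by (auto simp: pos_sphere_def)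
  then show ?thesis
    by (simp only: upper_monotonicity_modulus_def cInf_singleton)
qed

theorem proposition6p1:
  assumes "\<exists>x :: 'a::banach_lattice. x \<noteq> 0"
  shows "(\<forall>\<epsilon>\<in>{0..1}. lattice_schaeffer_const TYPE('a)
            \<le> upper_monotonicity_modulus TYPE('a) \<epsilon> + 2 - \<epsilon>)
         \<and> upper_monotonicity_char TYPE('a) \<le> 2 - lattice_schaeffer_const TYPE('a)"
proof -
  from assms obtain u :: 'a where u: "u \<in> pos_sphere"
    using pos_sphere_nonempty by blast
  note bound = lattice_schaeffer_const_le_modulus[OF u]
  have "upper_monotonicity_char TYPE('a) \<le> 2 - lattice_schaeffer_const TYPE('a)"
    unfolding upper_monotonicity_char_def
  proof (rule cSup_least)
    show "{\<epsilon>. 0 \<le> \<epsilon> \<and> \<epsilon> < 1 \<and> upper_monotonicity_modulus TYPE('a) \<epsilon> = 0} \<noteq> {}"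
      using upper_monotonicity_modulus_0[OF u] by (auto intro!: exI[of _ 0])
  next
    fix \<epsilon> assume "\<epsilon> \<in> {\<epsilon>. 0 \<le> \<epsilon> \<and> \<epsilon> < 1 \<and> upper_monotonicity_modulus TYPE('a) \<epsilon> = 0}"
    with bound[of \<epsilon>] show "\<epsilon> \<le> 2 - lattice_schaeffer_const TYPE('a)"
      by simp
  qed
  with bound show ?thesis
    by simp
qed

end
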